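(* Suppose $\epsilon_1,\dots,\epsilon_n$ are i.i.d. $N(0,\sigma^2)$. Let $$\Theta^*=\Bigl\{\boldsymbol{\theta}\in\mathbb{R}^p:0\le|\theta_j|\le\sqrt{2\sigma^2\log p/n},\ j=1,\dots,p\Bigr\},$$ and for $\Theta\subseteq\mathbb{R}^p$ let $\mathcal{C}(\Theta)=\{\boldsymbol{\mu}=\sum_{j=1}^p\theta_j\boldsymbol{\psi}_j:\boldsymbol{\theta}\in\Theta\}$. Then for any $\mathcal{C}(\Theta)$ with $\Theta^*\subseteq\Theta$: (i) if the dimension $p$ is fixed and $p\ge 2025$, then $$\min_{\hat{\boldsymbol{\mu}}}\max_{\boldsymbol{\mu}\in\mathcal{C}(\Theta)}\frac{R_n(\hat{\boldsymbol{\mu}},\boldsymbol{\mu})}{R_n(\hat{\boldsymbol{\mu}}_{\mathbf{w}^*|\mathcal{M}_{AS}},\boldsymbol{\mu})}>2;$$ (ii) if $p\to\infty$ as $n\to\infty$, then $$\min_{\hat{\boldsymbol{\mu}}}\max_{\boldsymbol{\mu}\in\mathcal{C}(\Theta)}\frac{R_n(\hat{\boldsymbol{\mu}},\boldsymbol{\mu})}{R_n(\hat{\boldsymbol{\mu}}_{\mathbf{w}^*|\mathcal{M}_{AS}},\boldsymbol{\mu})}\ge[1+o(1)]\,2\log p .$$ Here the minimum is taken over all measurable estimators $\hat{\boldsymbol{\mu}}$ based on $\mathbf{y}$.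
   Context: Model: $\mathbf{y}=\boldsymbol{\mu}+\boldsymbol{\epsilon}$ in $\mathbb{R}^n$ with $\boldsymbol{\epsilon}=(\epsilon_1,\dots,\epsilon_n)^\top$. $\|\cdot\|$ is the Euclidean norm. For an estimator $\hat{\boldsymbol{\mu}}$ (a measurable function of $\mathbf{y}$) the risk is $R_n(\hat{\boldsymbol{\mu}},\boldsymbol{\mu})=n^{-1}\mathbb{E}\|\hat{\boldsymbol{\mu}}-\boldsymbol{\mu}\|^2$, where the expectation is under true mean $\boldsymbol{\mu}$. "$\min$" and "$\max$" are understood as infimum and supremum. $\sigma^2>0$ does not depend on $n$, and $o(1)$ denotes a quantity tending to $0$ as $n\to\infty$. Complete orthogonal basis: $\boldsymbol{\psi}_1,\dots,\boldsymbol{\psi}_p\in\mathbb{R}^n$ ($1\le p\le n$) are given with $n^{-1}\|\boldsymbol{\psi}_j\|^2=1$ and $\boldsymbol{\psi}_j^\top\boldsymbol{\psi}_{j'}=0$ for $j\ne j'$, and the true mean vector has the representation $\boldsymbol{\mu}=\sum_{j=1}^p\theta_j\boldsymbol{\psi}_j$. All-subset model averaging: for $\mathcal{I}\subseteq\{1,\dots,p\}$ let $\hat{\boldsymbol{\mu}}_{\mathcal{I}}$ be the orthogonal projection of $\mathbf{y}$ onto $\operatorname{span}\{\boldsymbol{\psi}_j:j\in\mathcal{I}\}$ (so $\hat{\boldsymbol{\mu}}_{\emptyset}=\boldsymbol 0$). Let $\mathcal{M}_{AS}=\{\mathcal{I}:\mathcal{I}\subseteq\{1,\dots,p\}\}$,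 and for weights $\mathbf{w}=(w_{\mathcal{I}})_{\mathcal{I}}$ with $w_{\mathcal{I}}\in[0,1]$ and $\sum_{\mathcal{I}}w_{\mathcal{I}}=1$ let $\hat{\boldsymbol{\mu}}_{\mathbf{w}|\mathcal{M}_{AS}}=\sum_{\mathcal{I}}w_{\mathcal{I}}\hat{\boldsymbol{\mu}}_{\mathcal{I}}$. The optimal all-subset model averaging risk is $R_n(\hat{\boldsymbol{\mu}}_{\mathbf{w}^*|\mathcal{M}_{AS}},\boldsymbol{\mu})=\min_{\mathbf{w}}R_n(\hat{\boldsymbol{\mu}}_{\mathbf{w}|\mathcal{M}_{AS}},\boldsymbol{\mu})$, the minimum being over such deterministic weights. *)

theory Defs
  imports "HOL-Probability.Probability"
begin

text \<open>
  Vectors in \<open>\<real>\<^sup>n\<close> are functions on \<open>nat\<close> that are undefined outside \<open>{1..n}\<close>, i.e. the points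
  of the product space \<open>borel_vec n\<close>. The dimension is a term rather than a type because it tends
  to infinity.
\<close>

definition vecs :: "nat \<Rightarrow> (nat \<Rightarrow> real) set" where
  "vecs n = ({1..n} \<rightarrow>\<^sub>E UNIV)"

definition borel_vec :: "nat \<Rightarrow> (nat \<Rightarrow> real) measure" where
  "borel_vec n = (\<Pi>\<^sub>M i\<in>{1..n}. borel)"

definition dot :: "nat \<Rightarrow> (nat \<Rightarrow> real) \<Rightarrow> (nat \<Rightarrow> real) \<Rightarrow> real" where
  "dot n x y = (\<Sum>i = 1..n. x i * y i)"

abbreviation norm_vec :: "nat \<Rightarrow> (nat \<Rightarrow> real) \<Rightarrow> real" where
  "norm_vec n x \<equiv> L2_set x {1..n}"

definition lincomb :: "nat \<Rightarrow> (nat \<Rightarrow> nat \<Rightarrow> real) \<Rightarrow> nat set \<Rightarrow> (nat \<Rightarrow> real) \<Rightarrow> (nat \<Rightarrow> real)" where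
  "lincomb n \<psi> I c = (\<lambda>i\<in>{1..n}. \<Sum>j\<in>I. c j * \<psi> j i)"

definition span_vecs :: "nat \<Rightarrow> (nat \<Rightarrow> nat \<Rightarrow> real) \<Rightarrow> nat set \<Rightarrow> (nat \<Rightarrow> real) set" where
  "span_vecs n \<psi> I = range (lincomb n \<psi> I)"

definition orth_proj :: "nat \<Rightarrow> (nat \<Rightarrow> real) set \<Rightarrow> (nat \<Rightarrow> real) \<Rightarrow> (nat \<Rightarrow> real)" where
  "orth_proj n S y = (THE v. v \<in> S \<and> (\<forall>u\<in>S. dot n (\<lambda>i. y i - v i) u = 0))"

definition complete_orthogonal_basis :: "nat \<Rightarrow> nat \<Rightarrow> (nat \<Rightarrow> nat \<Rightarrow> real) \<Rightarrow> bool" where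
  "complete_orthogonal_basis n p \<psi> \<longleftrightarrow>
     1 \<le> p \<and> p \<le> n \<and>
     (\<forall>j\<in>{1..p}. (norm_vec n (\<psi> j))\<^sup>2 / real n = 1) \<and>
     (\<forall>j\<in>{1..p}. \<forall>k\<in>{1..p}. j \<noteq> k \<longrightarrow> dot n (\<psi> j) (\<psi> k) = 0)"

definition iid_normal_errors :: "nat \<Rightarrow> real \<Rightarrow> 'a measure \<Rightarrow> (nat \<Rightarrow> 'a \<Rightarrow> real) \<Rightarrow> bool" where
  "iid_normal_errors n \<sigma> M \<epsilon> \<longleftrightarrow>
     prob_space M \<and>
     prob_space.indep_vars M (\<lambda>_. borel) \<epsilon> {1..n} \<and>
     (\<forall>i\<in>{1..n}. distributed M lborel (\<epsilon> i) (normal_density 0 \<sigma>))"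

definition observation ::
    "nat \<Rightarrow> (nat \<Rightarrow> 'a \<Rightarrow> real) \<Rightarrow> (nat \<Rightarrow> real) \<Rightarrow> 'a \<Rightarrow> (nat \<Rightarrow> real)" where
  "observation n \<epsilon> \<mu> \<omega> = (\<lambda>i\<in>{1..n}. \<mu> i + \<epsilon> i \<omega>)"

definition estimators :: "nat \<Rightarrow> ((nat \<Rightarrow> real) \<Rightarrow> (nat \<Rightarrow> real)) set" where
  "estimators n = borel_vec n \<rightarrow>\<^sub>M borel_vec n"

text \<open>The risk of an arbitrary measurable estimator may be infinite, hence the type \<open>ennreal\<close>.\<close>

definition risk ::
    "nat \<Rightarrow> 'a measure \<Rightarrow> (nat \<Rightarrow> 'a \<Rightarrow> real) \<Rightarrow> ((nat \<Rightarrow> real) \<Rightarrow> (nat \<Rightarrow> real))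
      \<Rightarrow> (nat \<Rightarrow> real) \<Rightarrow> ennreal" where
  "risk n M \<epsilon> est \<mu> =
     (\<integral>\<^sup>+\<omega>. ennreal ((norm_vec n (\<lambda>i. est (observation n \<epsilon> \<mu> \<omega>) i - \<mu> i))\<^sup>2) \<partial>M) / of_nat n"

definition subset_weights :: "nat \<Rightarrow> (nat set \<Rightarrow> real) set" where
  "subset_weights p =
     {w. (\<forall>I\<in>Pow {1..p}. w I \<in> {0..1}) \<and> (\<Sum>I\<in>Pow {1..p}. w I) = 1}"

definition subset_averaging ::
    "nat \<Rightarrow> nat \<Rightarrow> (nat \<Rightarrow> nat \<Rightarrow> real) \<Rightarrow> (nat set \<Rightarrow> real)
      \<Rightarrow> (nat \<Rightarrow> real) \<Rightarrow> (nat \<Rightarrow> real)" where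
  "subset_averaging n p \<psi> w y =
     (\<lambda>i\<in>{1..n}. \<Sum>I\<in>Pow {1..p}. w I * orth_proj n (span_vecs n \<psi> I) y i)"

definition optimal_averaging_risk ::
    "nat \<Rightarrow> nat \<Rightarrow> 'a measure \<Rightarrow> (nat \<Rightarrow> 'a \<Rightarrow> real) \<Rightarrow> (nat \<Rightarrow> nat \<Rightarrow> real)
      \<Rightarrow> (nat \<Rightarrow> real) \<Rightarrow> ennreal" where
  "optimal_averaging_risk n p M \<epsilon> \<psi> \<mu> =
     (INF w\<in>subset_weights p. risk n M \<epsilon> (subset_averaging n p \<psi> w) \<mu>)"

definition Theta_star :: "nat \<Rightarrow> nat \<Rightarrow> real \<Rightarrow> (nat \<Rightarrow> real) set" where
  "Theta_star n p \<sigma> =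
     {\<theta> \<in> vecs p. \<forall>j\<in>{1..p}. \<bar>\<theta> j\<bar> \<in> {0..sqrt (2 * \<sigma>\<^sup>2 * ln (real p) / real n)}}"

definition mean_class ::
    "nat \<Rightarrow> nat \<Rightarrow> (nat \<Rightarrow> nat \<Rightarrow> real) \<Rightarrow> (nat \<Rightarrow> real) set \<Rightarrow> (nat \<Rightarrow> real) set" where
  "mean_class n p \<psi> \<Theta> = lincomb n \<psi> {1..p} ` \<Theta>"

text \<open>
  The optimal averaging risk vanishes at \<open>\<mu> = 0\<close> (put all weight on the empty subset), so the ratio
  is undefined there. The supremum is taken over those means of the class at which the ratio is
  defined; a lower bound for it is also a lower bound for the supremum over the whole class,
  whichever value in \<open>[0, \<infinity>]\<close> is assigned to the ratio at the excluded points.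
\<close>

definition minimax_risk_ratio ::
    "nat \<Rightarrow> nat \<Rightarrow> 'a measure \<Rightarrow> (nat \<Rightarrow> 'a \<Rightarrow> real) \<Rightarrow> (nat \<Rightarrow> nat \<Rightarrow> real)
      \<Rightarrow> (nat \<Rightarrow> real) set \<Rightarrow> ennreal" where
  "minimax_risk_ratio n p M \<epsilon> \<psi> \<Theta> =
     (INF est\<in>estimators n.
        SUP \<mu>\<in>{\<mu> \<in> mean_class n p \<psi> \<Theta>. optimal_averaging_risk n p M \<epsilon> \<psi> \<mu> \<noteq> 0}.
          risk n M \<epsilon> est \<mu> / optimal_averaging_risk n p M \<epsilon> \<psi> \<mu>)"

end

theory Submission
  imports Defs
begin

text \<open>
  The optimal averaging risk tends to zero when the mean tends to the origin, because the empty subset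
  estimates the zero vector. An estimator whose risk stays within a finite factor of it must therefore
  have risk tending to zero near the origin. All Gaussian laws with the same variance are mutually
  absolutely continuous with densities depending continuously on the mean, so Fatou's lemma carries
  this to the origin itself: there the estimator has risk zero, which means that it vanishes almost
  everywhere, and then it does so under every mean (\<open>AE_zero_if_risk_vanishes\<close>). Every estimator thus
  either has infinite worst-case ratio or is the zero estimator up to null sets.

  The zero estimator has risk \<open>\<Sum>\<^sub>j \<theta>\<^sub>j\<^sup>2\<close> (\<open>risk_of_AE_zero_estimator\<close>, \<open>parseval\<close>). When all coefficients
  equal \<open>t\<close>, the optimal averaging risk is \<open>p t\<^sup>2 v / (t\<^sup>2 + v)\<close> with \<open>v = \<sigma>\<^sup>2 / n\<close>, the usual trade-off
  of squared bias against variance (\<open>optimal_averaging_risk_constant\<close>). At the corner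
  \<open>t\<^sup>2 = 2 v ln p\<close> of the parameter cube the ratio of the two is \<open>1 + 2 ln p\<close>. This single bound
  (\<open>minimax_risk_ratio_ge\<close>) holds for every \<open>n\<close> and every \<open>p \<ge> 2\<close>; it exceeds \<open>2\<close> once \<open>p \<ge> 3\<close>, and
  it exceeds \<open>2 ln p\<close> always.
\<close>

section \<open>The law of the observation\<close>

text \<open>
  Both sides give the same mass to a box: there the integrand is a product of functions of single
  coordinates, and its integral factorizes.
\<close>

lemma (in product_sigma_finite) density_PiM:
  assumes I: "finite I"
    and f [measurable]: "\<And>i. f i \<in> borel_measurable (M i)"
    and sf: "\<And>i. sigma_finite_measure (density (M i) (f i))"
  shows "density (PiM I M) (\<lambda>y. \<Prod>i\<in>I. f i (y i)) = PiM I (\<lambda>i. density (M i) (f i))"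
proof -
  interpret D: product_sigma_finite "\<lambda>i. density (M i) (f i)"
    using sf by (simp add: product_sigma_finite_def)
  show ?thesis
  proof (rule D.PiM_eqI[OF I])
    show "sets (density (PiM I M) (\<lambda>y. \<Prod>i\<in>I. f i (y i))) = sets (PiM I (\<lambda>i. density (M i) (f i)))"
      by (simp cong: sets_PiM_cong)
  next
    fix A assume "\<And>i. i \<in> I \<Longrightarrow> A i \<in> sets (density (M i) (f i))"
    then have A: "\<And>i. i \<in> I \<Longrightarrow> A i \<in> sets (M i)" by simp
    have "emeasure (density (PiM I M) (\<lambda>y. \<Prod>i\<in>I. f i (y i))) (Pi\<^sub>E I A)
        = (\<integral>\<^sup>+y. (\<Prod>i\<in>I. f i (y i)) * indicator (Pi\<^sub>E I A) y \<partial>PiM I M)"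
      using A I by (intro emeasure_density) (auto intro!: sets_PiM_I_finite borel_measurable_prod_ennreal)
    also have "\<dots> = (\<integral>\<^sup>+y. (\<Prod>i\<in>I. f i (y i) * indicator (A i) (y i)) \<partial>PiM I M)"
    proof (rule nn_integral_cong)
      fix y assume "y \<in> space (PiM I M)"
      then have "y \<in> extensional I" by (auto simp: space_PiM PiE_def)
      then have "indicator (Pi\<^sub>E I A) y = (\<Prod>i\<in>I. indicator (A i) (y i) :: ennreal)"
        using I by (auto simp: indicator_def PiE_def Pi_def prod_zero_iff)
      then show "(\<Prod>i\<in>I. f i (y i)) * indicator (Pi\<^sub>E I A) y
          = (\<Prod>i\<in>I. f i (y i) * indicator (A i) (y i))"
        by (simp add: prod.distrib)
    qed
    also have "\<dots> = (\<Prod>i\<in>I. \<integral>\<^sup>+x. f i x * indicator (A i) x \<partial>M i)"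
      using A I by (intro product_nn_integral_prod) auto
    also have "\<dots> = (\<Prod>i\<in>I. emeasure (density (M i) (f i)) (A i))"
      using A by (intro prod.cong refl) (simp add: emeasure_density)
    finally show "emeasure (density (PiM I M) (\<lambda>y. \<Prod>i\<in>I. f i (y i))) (Pi\<^sub>E I A)
        = (\<Prod>i\<in>I. emeasure (density (M i) (f i)) (A i))" .
  qed
qed

abbreviation lborel_vec :: "nat \<Rightarrow> (nat \<Rightarrow> real) measure" where
  "lborel_vec n \<equiv> \<Pi>\<^sub>M i\<in>{1..n}. lborel"

text \<open>
  Under every mean the observation has a strictly positive density with respect to one fixed
  reference measure. This makes it possible to compare risks under different means: only the weight
  in front of the loss moves with the mean, and null sets are the same for all means.
\<close>

lemma nn_integral_observation:
  assumes \<sigma>: "\<sigma> > 0"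
    and iid: "iid_normal_errors n \<sigma> M \<epsilon>"
    and n: "n \<ge> 1"
    and g: "g \<in> borel_measurable (borel_vec n)"
  shows "(\<integral>\<^sup>+\<omega>. g (observation n \<epsilon> \<mu> \<omega>) \<partial>M)
    = (\<integral>\<^sup>+y. (\<Prod>i = 1..n. ennreal (normal_density (\<mu> i) \<sigma> (y i))) * g y \<partial>lborel_vec n)"
proof -
  interpret prob_space M using iid by (simp add: iid_normal_errors_def)
  interpret L: product_sigma_finite "\<lambda>i::nat. lborel :: real measure" ..
  let ?Y = "\<lambda>i \<omega>. \<mu> i + \<epsilon> i \<omega>"
  let ?D = "\<lambda>i. density lborel (\<lambda>x. ennreal (normal_density (\<mu> i) \<sigma> x))"
  have indep: "indep_vars (\<lambda>_. borel) \<epsilon> {1..n}"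
    and eps: "\<And>i. i \<in> {1..n} \<Longrightarrow> distributed M lborel (\<epsilon> i) (normal_density 0 \<sigma>)"
    using iid by (auto simp: iid_normal_errors_def)
  have indepY: "indep_vars (\<lambda>_. borel) ?Y {1..n}"
    by (rule indep_vars_compose2[OF indep]) simp
  have Y: "distributed M lborel (?Y i) (normal_density (\<mu> i) \<sigma>)" if "i \<in> {1..n}" for i
    using normal_density_affine[OF eps[OF that] \<sigma>, of 1 "\<mu> i"] by simp
  have rv: "random_variable borel (?Y i)" if "i \<in> {1..n}" for i
    using distributed_measurable[OF Y[OF that]] by simp
  have obs: "observation n \<epsilon> \<mu> = (\<lambda>\<omega>. \<lambda>i\<in>{1..n}. ?Y i \<omega>)"
    by (simp add: observation_def fun_eq_iff)
  have meas: "observation n \<epsilon> \<mu> \<in> M \<rightarrow>\<^sub>M borel_vec n"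
    unfolding obs borel_vec_def by (intro measurable_restrict rv)
  have "distr M (borel_vec n) (observation n \<epsilon> \<mu>) = PiM {1..n} (\<lambda>i. distr M borel (?Y i))"
    using indep_vars_iff_distr_eq_PiM'[where I="{1..n}" and X="?Y" and M'="\<lambda>_. borel"] indepY rv n
    by (simp add: obs borel_vec_def)
  also have "\<dots> = PiM {1..n} ?D"
  proof (rule PiM_cong[OF refl])
    fix i assume i: "i \<in> {1..n}"
    have "distr M borel (?Y i) = distr M lborel (?Y i)" by (rule distr_cong) simp_all
    also have "\<dots> = ?D i" using distributed_distr_eq_density[OF Y[OF i]] .
    finally show "distr M borel (?Y i) = ?D i" .
  qed
  also have "\<dots> = density (lborel_vec n) (\<lambda>y. \<Prod>i = 1..n. ennreal (normal_density (\<mu> i) \<sigma> (y i)))"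
    by (rule L.density_PiM[symmetric])
      (auto intro!: prob_space_imp_sigma_finite prob_space_normal_density \<sigma>)
  finally have law: "distr M (borel_vec n) (observation n \<epsilon> \<mu>) = \<dots>" .
  have g': "g \<in> borel_measurable (lborel_vec n)"
    using g by (simp add: borel_vec_def cong: measurable_cong_sets sets_PiM_cong)
  have "(\<integral>\<^sup>+\<omega>. g (observation n \<epsilon> \<mu> \<omega>) \<partial>M)
      = (\<integral>\<^sup>+y. g y \<partial>distr M (borel_vec n) (observation n \<epsilon> \<mu>))"
    using meas g by (simp add: nn_integral_distr)
  also have "\<dots> = (\<integral>\<^sup>+y. (\<Prod>i = 1..n. ennreal (normal_density (\<mu> i) \<sigma> (y i))) * g y \<partial>lborel_vec n)"
    unfolding law by (rule nn_integral_density) (use g' in auto)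
  finally show ?thesis .
qed

lemma error_moments:
  assumes \<sigma>: "\<sigma> > 0" and iid: "iid_normal_errors n \<sigma> M \<epsilon>"
    and i: "i \<in> {1..n}" and k: "k \<in> {1..n}"
  shows "has_bochner_integral M (\<epsilon> i) 0"
    and "has_bochner_integral M (\<lambda>\<omega>. \<epsilon> i \<omega> * \<epsilon> k \<omega>) (if i = k then \<sigma>\<^sup>2 else 0)"
proof -
  interpret prob_space M using iid by (simp add: iid_normal_errors_def)
  have indep: "indep_vars (\<lambda>_. borel) \<epsilon> {1..n}"
    and eps: "\<And>i. i \<in> {1..n} \<Longrightarrow> distributed M lborel (\<epsilon> i) (normal_density 0 \<sigma>)"
    using iid by (auto simp: iid_normal_errors_def)
  have int: "integrable M (\<epsilon> j)" if "j \<in> {1..n}" for j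
    using distributed_integrable[OF eps[OF that], of "\<lambda>x. x"] integrable_normal_moment_nz_1[OF \<sigma>, of 0]
    by simp
  have ex: "expectation (\<epsilon> j) = 0" if "j \<in> {1..n}" for j
    using normal_distributed_expectation[OF \<sigma> eps[OF that]] .
  show "has_bochner_integral M (\<epsilon> i) 0"
    using int[OF i] ex[OF i] by (simp add: has_bochner_integral_iff)
  show "has_bochner_integral M (\<lambda>\<omega>. \<epsilon> i \<omega> * \<epsilon> k \<omega>) (if i = k then \<sigma>\<^sup>2 else 0)"
  proof (cases "i = k")
    case True
    have "integrable M (\<lambda>\<omega>. (\<epsilon> i \<omega>)\<^sup>2)"
      using distributed_integrable[OF eps[OF i], of "\<lambda>x. x\<^sup>2"] integrable_normal_moment[OF \<sigma>, of 0 2]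
      by simp
    moreover have "expectation (\<lambda>\<omega>. (\<epsilon> i \<omega>)\<^sup>2) = \<sigma>\<^sup>2"
      using normal_distributed_variance[OF \<sigma> eps[OF i]] ex[OF i] by simp
    ultimately show ?thesis using True by (simp add: has_bochner_integral_iff power2_eq_square)
  next
    case False
    have ik: "indep_vars (\<lambda>_. borel) \<epsilon> {i, k}"
      by (rule indep_vars_subset[OF indep]) (use i k in auto)
    have int_ik: "integrable M (\<epsilon> j)" if "j \<in> {i, k}" for j
      using that int i k by auto
    have "integrable M (\<lambda>\<omega>. \<Prod>j\<in>{i, k}. \<epsilon> j \<omega>)"
      by (rule indep_vars_integrable[OF _ ik int_ik]) simp
    moreover have "expectation (\<lambda>\<omega>. \<Prod>j\<in>{i, k}. \<epsilon> j \<omega>) = (\<Prod>j\<in>{i, k}. expectation (\<epsilon> j))"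
      by (rule indep_vars_lebesgue_integral[OF _ ik int_ik]) simp
    ultimately show ?thesis
      using False ex[OF i] by (simp add: has_bochner_integral_iff)
  qed
qed

section \<open>Bias and variance of all-subset averaging\<close>

lemma norm_vec_squared: "(norm_vec n x)\<^sup>2 = dot n x x"
  by (simp add: L2_set_def dot_def sum_nonneg power2_eq_square)

lemma basis_dot:
  assumes "complete_orthogonal_basis n p \<psi>" "j \<in> {1..p}" "k \<in> {1..p}"
  shows "dot n (\<psi> j) (\<psi> k) = (if j = k then real n else 0)"
proof (cases "j = k")
  case True
  have "real n > 0"
    using assms(1) by (auto simp: complete_orthogonal_basis_def)
  moreover have "(norm_vec n (\<psi> j))\<^sup>2 / real n = 1"
    using assms unfolding complete_orthogonal_basis_def by blast
  ultimately have "(norm_vec n (\<psi> j))\<^sup>2 = real n" by simp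
  then show ?thesis
    using True unfolding norm_vec_squared by simp
qed (use assms in \<open>auto simp: complete_orthogonal_basis_def\<close>)

lemma dot_lincomb:
  "dot n x (lincomb n \<psi> I c) = (\<Sum>j\<in>I. c j * dot n (\<psi> j) x)"
  by (simp add: dot_def lincomb_def sum_distrib_left sum_distrib_right mult_ac sum.swap[of _ I])

lemma dot_basis_lincomb:
  assumes "complete_orthogonal_basis n p \<psi>" "I \<subseteq> {1..p}" "k \<in> I"
  shows "dot n (\<psi> k) (lincomb n \<psi> I c) = real n * c k"
proof -
  have fin: "finite I" using assms finite_subset by blast
  have "dot n (\<psi> k) (lincomb n \<psi> I c) = (\<Sum>j\<in>I. if j = k then real n * c k else 0)"
    unfolding dot_lincomb using assms
    by (intro sum.cong refl) (subst basis_dot[OF assms(1)], auto)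
  also have "\<dots> = real n * c k" using fin assms(3) by simp
  finally show ?thesis .
qed

lemma parseval:
  assumes "complete_orthogonal_basis n p \<psi>"
  shows "(norm_vec n (lincomb n \<psi> {1..p} c))\<^sup>2 = real n * (\<Sum>j = 1..p. (c j)\<^sup>2)"
proof -
  have "(norm_vec n (lincomb n \<psi> {1..p} c))\<^sup>2
      = (\<Sum>j = 1..p. c j * dot n (\<psi> j) (lincomb n \<psi> {1..p} c))"
    unfolding norm_vec_squared by (rule dot_lincomb)
  also have "\<dots> = (\<Sum>j = 1..p. c j * (real n * c j))"
    by (intro sum.cong refl) (subst dot_basis_lincomb[OF assms], auto)
  finally show ?thesis by (simp add: sum_distrib_left power2_eq_square mult_ac)
qed

text \<open>
  The residual of the stated combination is orthogonal to each basis vector of the span. Conversely,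
  testing the residual of any candidate against a single basis vector determines its coefficient.
\<close>

lemma orth_proj_span:
  assumes basis: "complete_orthogonal_basis n p \<psi>" and I: "I \<subseteq> {1..p}"
  shows "orth_proj n (span_vecs n \<psi> I) y = lincomb n \<psi> I (\<lambda>j. dot n (\<psi> j) y / real n)"
proof -
  let ?c = "\<lambda>j. dot n (\<psi> j) y / real n"
  have n: "real n > 0" using basis by (auto simp: complete_orthogonal_basis_def)
  have diff: "dot n (\<lambda>i. y i - v i) u = dot n u y - dot n u v" for u v
    by (simp add: dot_def sum_subtractf algebra_simps)
  have sym: "dot n u v = dot n v u" for u v by (simp add: dot_def mult.commute)
  show ?thesis
    unfolding orth_proj_def
  proof (rule the_equality)
    have "dot n (\<lambda>i. y i - lincomb n \<psi> I ?c i) (lincomb n \<psi> I d) = 0" for d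
    proof -
      have "dot n (\<psi> j) (\<lambda>i. y i - lincomb n \<psi> I ?c i) = 0" if "j \<in> I" for j
        using dot_basis_lincomb[OF basis I that, of ?c] n
        by (subst sym) (simp add: diff)
      then show ?thesis by (simp add: dot_lincomb)
    qed
    then show "lincomb n \<psi> I ?c \<in> span_vecs n \<psi> I
        \<and> (\<forall>u\<in>span_vecs n \<psi> I. dot n (\<lambda>i. y i - lincomb n \<psi> I ?c i) u = 0)"
      by (auto simp: span_vecs_def)
  next
    fix v assume v: "v \<in> span_vecs n \<psi> I \<and> (\<forall>u\<in>span_vecs n \<psi> I. dot n (\<lambda>i. y i - v i) u = 0)"
    then obtain c where c: "v = lincomb n \<psi> I c" by (auto simp: span_vecs_def)
    have fin: "finite I" using I finite_subset by blast
    have "c j = ?c j" if j: "j \<in> I" for j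
    proof -
      have e: "dot n x (lincomb n \<psi> I (\<lambda>k. if k = j then 1 else 0)) = dot n (\<psi> j) x" for x
        using fin j by (simp add: dot_lincomb if_distrib[of "\<lambda>a. a * _"] cong: if_cong)
      have "dot n (\<psi> j) (\<lambda>i. y i - v i) = 0"
        using v by (subst e[symmetric]) (auto simp: span_vecs_def)
      then have "dot n (\<psi> j) y = dot n (\<psi> j) v" by (subst (asm) sym) (simp add: diff)
      also have "\<dots> = real n * c j" unfolding c by (rule dot_basis_lincomb[OF basis I j])
      finally show ?thesis using n by simp
    qed
    then show "v = lincomb n \<psi> I ?c" unfolding c lincomb_def by (auto intro!: sum.cong)
  qed
qed

text \<open>
  Averaging the subset projections multiplies the \<open>j\<close>-th empirical coefficient by the total weight of
  the subsets that contain \<open>j\<close>; the risk depends on the weights only through these \<open>p\<close> numbers.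
\<close>

definition inclusion_weight :: "nat \<Rightarrow> (nat set \<Rightarrow> real) \<Rightarrow> nat \<Rightarrow> real" where
  "inclusion_weight p w j = (\<Sum>I\<in>Pow {1..p}. if j \<in> I then w I else 0)"

lemma subset_averaging_shrinkage:
  assumes basis: "complete_orthogonal_basis n p \<psi>"
  shows "subset_averaging n p \<psi> w y
    = lincomb n \<psi> {1..p} (\<lambda>j. inclusion_weight p w j * (dot n (\<psi> j) y / real n))"
proof
  fix i
  let ?c = "\<lambda>j. dot n (\<psi> j) y / real n"
  show "subset_averaging n p \<psi> w y i = lincomb n \<psi> {1..p} (\<lambda>j. inclusion_weight p w j * ?c j) i"
  proof (cases "i \<in> {1..n}")
    case True
    have "subset_averaging n p \<psi> w y i = (\<Sum>I\<in>Pow {1..p}. w I * (\<Sum>j\<in>I. ?c j * \<psi> j i))"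
      unfolding subset_averaging_def using True
      by (auto intro!: sum.cong simp: orth_proj_span[OF basis] lincomb_def)
    also have "\<dots> = (\<Sum>I\<in>Pow {1..p}. \<Sum>j = 1..p. (if j \<in> I then w I else 0) * (?c j * \<psi> j i))"
    proof (intro sum.cong refl)
      fix I assume "I \<in> Pow {1..p}"
      then have I: "{1..p} \<inter> I = I" by auto
      have "(\<Sum>j = 1..p. (if j \<in> I then w I else 0) * (?c j * \<psi> j i))
          = (\<Sum>j = 1..p. if j \<in> I then w I * (?c j * \<psi> j i) else 0)"
        by (intro sum.cong) auto
      also have "\<dots> = (\<Sum>j\<in>{1..p} \<inter> I. w I * (?c j * \<psi> j i))"
        by (rule sum.inter_restrict[symmetric]) simp
      finally show "w I * (\<Sum>j\<in>I. ?c j * \<psi> j i)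
          = (\<Sum>j = 1..p. (if j \<in> I then w I else 0) * (?c j * \<psi> j i))"
        by (simp only: I sum_distrib_left)
    qed
    also have "\<dots> = (\<Sum>j = 1..p. inclusion_weight p w j * ?c j * \<psi> j i)"
      by (subst sum.swap) (simp add: inclusion_weight_def sum_distrib_right sum_divide_distrib mult.assoc)
    finally show ?thesis using True by (simp add: lincomb_def)
  qed (auto simp: subset_averaging_def lincomb_def)
qed

text \<open>
  The empirical coefficients are the true ones plus centred noise of variance \<open>\<sigma>\<^sup>2 / n\<close>; the cross
  terms in the second moment vanish by independence.
\<close>

lemma noise_coefficient_moments:
  assumes \<sigma>: "\<sigma> > 0" and iid: "iid_normal_errors n \<sigma> M \<epsilon>"
    and basis: "complete_orthogonal_basis n p \<psi>" and j: "j \<in> {1..p}"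
  defines "e \<equiv> \<lambda>\<omega>. dot n (\<psi> j) (\<lambda>i. \<epsilon> i \<omega>) / real n"
  shows "has_bochner_integral M e 0"
    and "has_bochner_integral M (\<lambda>\<omega>. (e \<omega>)\<^sup>2) (\<sigma>\<^sup>2 / real n)"
proof -
  have n: "real n > 0" using basis by (auto simp: complete_orthogonal_basis_def)
  have "has_bochner_integral M (\<lambda>\<omega>. \<Sum>i = 1..n. \<psi> j i / real n * \<epsilon> i \<omega>)
      (\<Sum>i = 1..n. \<psi> j i / real n * 0)"
    by (intro has_bochner_integral_sum has_bochner_integral_mult_right error_moments(1)[OF \<sigma> iid]) auto
  then show "has_bochner_integral M e 0"
    by (simp add: e_def dot_def sum_divide_distrib)
  have "has_bochner_integral M
      (\<lambda>\<omega>. \<Sum>i = 1..n. \<Sum>k = 1..n. \<psi> j i * \<psi> j k / (real n)\<^sup>2 * (\<epsilon> i \<omega> * \<epsilon> k \<omega>))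
      (\<Sum>i = 1..n. \<Sum>k = 1..n. \<psi> j i * \<psi> j k / (real n)\<^sup>2 * (if i = k then \<sigma>\<^sup>2 else 0))"
    by (intro has_bochner_integral_sum has_bochner_integral_mult_right error_moments(2)[OF \<sigma> iid]) auto
  moreover have "(\<Sum>i = 1..n. \<Sum>k = 1..n. \<psi> j i * \<psi> j k / (real n)\<^sup>2 * (\<epsilon> i \<omega> * \<epsilon> k \<omega>)) = (e \<omega>)\<^sup>2"
    for \<omega>
    by (simp add: e_def dot_def power2_eq_square sum_product sum_divide_distrib algebra_simps)
  moreover have "(\<Sum>i = 1..n. \<Sum>k = 1..n. \<psi> j i * \<psi> j k / (real n)\<^sup>2 * (if i = k then \<sigma>\<^sup>2 else 0))
      = dot n (\<psi> j) (\<psi> j) * \<sigma>\<^sup>2 / (real n)\<^sup>2"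
    by (simp add: if_distrib[of "\<lambda>a. _ * a"] dot_def sum_divide_distrib sum_distrib_right cong: if_cong)
  moreover have "dot n (\<psi> j) (\<psi> j) * \<sigma>\<^sup>2 / (real n)\<^sup>2 = \<sigma>\<^sup>2 / real n"
    using n basis_dot[OF basis j j] by (simp add: power2_eq_square)
  ultimately show "has_bochner_integral M (\<lambda>\<omega>. (e \<omega>)\<^sup>2) (\<sigma>\<^sup>2 / real n)" by simp
qed

text \<open>
  Bias and variance of a diagonal shrinkage rule. By Parseval the loss is a sum over coordinates in
  which the inclusion weight \<open>\<lambda>\<^sub>j\<close> produces the error \<open>\<lambda>\<^sub>j e\<^sub>j - (1 - \<lambda>\<^sub>j) \<theta>\<^sub>j\<close>, with \<open>e\<^sub>j\<close> the noise of
  the \<open>j\<close>-th coefficient.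
\<close>

lemma subset_averaging_risk:
  assumes \<sigma>: "\<sigma> > 0" and iid: "iid_normal_errors n \<sigma> M \<epsilon>"
    and basis: "complete_orthogonal_basis n p \<psi>"
  shows "risk n M \<epsilon> (subset_averaging n p \<psi> w) (lincomb n \<psi> {1..p} \<theta>)
    = ennreal (\<Sum>j = 1..p. (1 - inclusion_weight p w j)\<^sup>2 * (\<theta> j)\<^sup>2
                          + (inclusion_weight p w j)\<^sup>2 * (\<sigma>\<^sup>2 / real n))"
proof -
  interpret prob_space M using iid by (simp add: iid_normal_errors_def)
  let ?\<mu> = "lincomb n \<psi> {1..p} \<theta>"
  let ?l = "inclusion_weight p w"
  let ?e = "\<lambda>j \<omega>. dot n (\<psi> j) (\<lambda>i. \<epsilon> i \<omega>) / real n"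
  let ?loss = "\<lambda>\<omega>. (norm_vec n (\<lambda>i. subset_averaging n p \<psi> w (observation n \<epsilon> ?\<mu> \<omega>) i - ?\<mu> i))\<^sup>2"
  let ?R = "\<Sum>j = 1..p. (1 - ?l j)\<^sup>2 * (\<theta> j)\<^sup>2 + (?l j)\<^sup>2 * (\<sigma>\<^sup>2 / real n)"
  have n: "real n > 0" using basis by (auto simp: complete_orthogonal_basis_def)
  have coef: "dot n (\<psi> j) (observation n \<epsilon> ?\<mu> \<omega>) / real n = \<theta> j + ?e j \<omega>" if "j \<in> {1..p}" for j \<omega>
  proof -
    have "dot n (\<psi> j) (observation n \<epsilon> ?\<mu> \<omega>) = dot n (\<psi> j) ?\<mu> + dot n (\<psi> j) (\<lambda>i. \<epsilon> i \<omega>)"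
      by (simp add: dot_def observation_def sum.distrib algebra_simps)
    also have "dot n (\<psi> j) ?\<mu> = real n * \<theta> j"
      by (rule dot_basis_lincomb[OF basis]) (use that in auto)
    finally show ?thesis using n by (simp add: field_simps)
  qed
  have loss: "?loss \<omega> = real n * (\<Sum>j = 1..p. (?l j * ?e j \<omega> - (1 - ?l j) * \<theta> j)\<^sup>2)" for \<omega>
  proof -
    let ?d = "\<lambda>j. ?l j * ?e j \<omega> - (1 - ?l j) * \<theta> j"
    have "subset_averaging n p \<psi> w (observation n \<epsilon> ?\<mu> \<omega>) i - ?\<mu> i = lincomb n \<psi> {1..p} ?d i"
      if i: "i \<in> {1..n}" for i
    proof -
      have "subset_averaging n p \<psi> w (observation n \<epsilon> ?\<mu> \<omega>) i - ?\<mu> i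
          = (\<Sum>j = 1..p. ?l j * (dot n (\<psi> j) (observation n \<epsilon> ?\<mu> \<omega>) / real n) * \<psi> j i - \<theta> j * \<psi> j i)"
        using i by (simp add: subset_averaging_shrinkage[OF basis] lincomb_def sum_subtractf)
      also have "\<dots> = (\<Sum>j = 1..p. ?d j * \<psi> j i)"
        by (intro sum.cong refl) (simp only: coef, simp add: algebra_simps)
      finally show ?thesis using i by (simp add: lincomb_def)
    qed
    then have "?loss \<omega> = (norm_vec n (lincomb n \<psi> {1..p} ?d))\<^sup>2"
      by (intro arg_cong[where f="\<lambda>a. a\<^sup>2"] L2_set_cong) auto
    then show ?thesis by (simp only: parseval[OF basis])
  qed
  have "has_bochner_integral M
      (\<lambda>\<omega>. real n * (\<Sum>j = 1..p. (?l j)\<^sup>2 * (?e j \<omega>)\<^sup>2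
         - (2 * ?l j * (1 - ?l j) * \<theta> j) * ?e j \<omega> + (1 - ?l j)\<^sup>2 * (\<theta> j)\<^sup>2))
      (real n * (\<Sum>j = 1..p. (?l j)\<^sup>2 * (\<sigma>\<^sup>2 / real n)
         - (2 * ?l j * (1 - ?l j) * \<theta> j) * 0 + (1 - ?l j)\<^sup>2 * (\<theta> j)\<^sup>2))"
    by (intro has_bochner_integral_mult_right has_bochner_integral_sum has_bochner_integral_add
          has_bochner_integral_diff noise_coefficient_moments[OF \<sigma> iid basis])
       (auto simp: has_bochner_integral_iff prob_space)
  moreover have "?loss \<omega> = real n * (\<Sum>j = 1..p. (?l j)\<^sup>2 * (?e j \<omega>)\<^sup>2
         - (2 * ?l j * (1 - ?l j) * \<theta> j) * ?e j \<omega> + (1 - ?l j)\<^sup>2 * (\<theta> j)\<^sup>2)" for \<omega>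
  proof -
    have "(l * x - (1 - l) * s)\<^sup>2 = l\<^sup>2 * x\<^sup>2 - (2 * l * (1 - l) * s) * x + (1 - l)\<^sup>2 * s\<^sup>2"
      for l x s :: real
      by (simp add: power2_eq_square algebra_simps)
    then show ?thesis unfolding loss by (simp only:)
  qed
  ultimately have "has_bochner_integral M ?loss (real n * ?R)"
    by (simp add: add.commute)
  then have "(\<integral>\<^sup>+\<omega>. ennreal (?loss \<omega>) \<partial>M) = ennreal (real n * ?R)"
    by (simp add: has_bochner_integral_iff nn_integral_eq_integral)
  then show ?thesis
    unfolding risk_def using n by (simp add: ennreal_of_nat_eq_real_of_nat divide_ennreal sum_nonneg)
qed

text \<open>
  If all coefficients equal \<open>t\<close>, the optimal shrinkage factor is the same in every coordinate, and a
  mixture of the full and the empty subset realizes it. Such means form a ray through the origin that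
  reaches a corner of the parameter cube, which is all that the lower bound uses. The formula also
  shows that the optimal risk is positive for \<open>t \<noteq> 0\<close>, so that the risk ratio is defined on the ray.
\<close>

lemma optimal_averaging_risk_constant:
  assumes \<sigma>: "\<sigma> > 0" and iid: "iid_normal_errors n \<sigma> M \<epsilon>"
    and basis: "complete_orthogonal_basis n p \<psi>"
    and \<theta>: "\<And>j. j \<in> {1..p} \<Longrightarrow> \<theta> j = t"
  defines "v \<equiv> \<sigma>\<^sup>2 / real n"
  shows "optimal_averaging_risk n p M \<epsilon> \<psi> (lincomb n \<psi> {1..p} \<theta>)
    = ennreal (real p * (t\<^sup>2 * v / (t\<^sup>2 + v)))"
proof (rule antisym)
  let ?\<mu> = "lincomb n \<psi> {1..p} \<theta>"
  have np: "real n > 0" "p \<ge> 1" using basis by (auto simp: complete_orthogonal_basis_def)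
  then have v: "v > 0" using \<sigma> by (simp add: v_def)
  then have tv: "t\<^sup>2 + v > 0" by (simp add: add_nonneg_pos)
  let ?a = "t\<^sup>2 / (t\<^sup>2 + v)"
  have a: "0 \<le> ?a" "?a \<le> 1" using tv v by (auto simp: divide_le_eq_1)
  \<comment> \<open>The minimizer of \<open>(1 - l)\<^sup>2 t\<^sup>2 + l\<^sup>2 v\<close> becomes the weight of the full subset, and the empty
    subset takes the rest.\<close>
  let ?w = "\<lambda>I. (if I = {1..p} then ?a else 0) + (if I = {} then 1 - ?a else 0)"
  have ne: "{1..p} \<noteq> {}" using np by simp
  have "(\<Sum>I\<in>Pow {1..p}. ?w I) = 1" by (simp add: sum.distrib)
  moreover have "?w I \<in> {0..1}" for I using a ne by auto
  ultimately have w: "?w \<in> subset_weights p" unfolding subset_weights_def by blast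
  have incl: "inclusion_weight p ?w j = ?a" if "j \<in> {1..p}" for j
  proof -
    have "inclusion_weight p ?w j = (\<Sum>I\<in>Pow {1..p}. if I = {1..p} then ?a else 0)"
      unfolding inclusion_weight_def using that by (intro sum.cong) auto
    then show ?thesis by simp
  qed
  have opt: "(1 - ?a)\<^sup>2 * t\<^sup>2 + ?a\<^sup>2 * v = t\<^sup>2 * v / (t\<^sup>2 + v)"
  proof -
    have a1: "1 - ?a = v / (t\<^sup>2 + v)" using tv by (simp add: field_simps)
    have "(1 - ?a)\<^sup>2 * t\<^sup>2 + ?a\<^sup>2 * v = (t\<^sup>2 * v) * (t\<^sup>2 + v) / (t\<^sup>2 + v)\<^sup>2"
      unfolding a1 power_divide by (simp add: algebra_simps power2_eq_square add_divide_distrib)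
    then show ?thesis using tv by (simp add: power2_eq_square)
  qed
  have "risk n M \<epsilon> (subset_averaging n p \<psi> ?w) ?\<mu>
      = ennreal (\<Sum>j = 1..p. (1 - ?a)\<^sup>2 * t\<^sup>2 + ?a\<^sup>2 * v)"
    unfolding subset_averaging_risk[OF \<sigma> iid basis] v_def[symmetric]
    by (intro arg_cong[where f=ennreal] sum.cong refl) (simp only: incl \<theta>)
  also have "\<dots> = ennreal (real p * (t\<^sup>2 * v / (t\<^sup>2 + v)))" unfolding opt by simp
  finally show "optimal_averaging_risk n p M \<epsilon> \<psi> ?\<mu> \<le> ennreal (real p * (t\<^sup>2 * v / (t\<^sup>2 + v)))"
    unfolding optimal_averaging_risk_def using w by (metis (no_types, lifting) INF_lower)
  show "ennreal (real p * (t\<^sup>2 * v / (t\<^sup>2 + v))) \<le> optimal_averaging_risk n p M \<epsilon> \<psi> ?\<mu>"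
    unfolding optimal_averaging_risk_def
  proof (rule INF_greatest)
    fix w assume "w \<in> subset_weights p"
    have min: "t\<^sup>2 * v / (t\<^sup>2 + v) \<le> (1 - l)\<^sup>2 * t\<^sup>2 + l\<^sup>2 * v" for l
    proof -
      \<comment> \<open>completing the square in \<open>l\<close>\<close>
      have "(t\<^sup>2 + v) * ((1 - l)\<^sup>2 * t\<^sup>2 + l\<^sup>2 * v) - t\<^sup>2 * v = ((t\<^sup>2 + v) * l - t\<^sup>2)\<^sup>2"
        by (simp add: power2_eq_square algebra_simps)
      then have "t\<^sup>2 * v \<le> (t\<^sup>2 + v) * ((1 - l)\<^sup>2 * t\<^sup>2 + l\<^sup>2 * v)"
        by (metis diff_ge_0_iff_ge zero_le_power2)
      then show ?thesis using tv by (simp add: pos_divide_le_eq mult.commute)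
    qed
    have "(\<Sum>j = 1..p. t\<^sup>2 * v / (t\<^sup>2 + v)) \<le>
        (\<Sum>j = 1..p. (1 - inclusion_weight p w j)\<^sup>2 * (\<theta> j)\<^sup>2 + (inclusion_weight p w j)\<^sup>2 * v)"
      by (rule sum_mono) (simp only: \<theta> min)
    then show "ennreal (real p * (t\<^sup>2 * v / (t\<^sup>2 + v)))
        \<le> risk n M \<epsilon> (subset_averaging n p \<psi> w) ?\<mu>"
      unfolding subset_averaging_risk[OF \<sigma> iid basis] v_def[symmetric]
      by (intro ennreal_leI) simp
  qed
qed

section \<open>Estimators whose risk vanishes at the origin\<close>

lemma divide_times_cancel_ennreal:
  fixes x c :: ennreal
  assumes "c \<noteq> 0" "c \<noteq> \<top>"
  shows "x / c * c = x"
  using assms by (simp add: ennreal_divide_times ennreal_divide_self less_top)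

lemma estimator_component_measurable:
  assumes "est \<in> estimators n" "i \<in> {1..n}"
  shows "(\<lambda>y. est y i) \<in> borel_measurable (borel_vec n)"
  using measurable_compose[OF _ measurable_component_singleton[OF assms(2), of "\<lambda>_. borel"], of est]
    assms(1) by (simp add: estimators_def borel_vec_def)

text \<open>
  The squared loss weighted by the density of the observation converges pointwise, as the means tend
  to the origin, to \<open>\<parallel>est y\<parallel>\<^sup>2\<close> times the density under mean zero. By Fatou's lemma the limit has
  integral zero, and the density is positive everywhere.
\<close>

lemma AE_zero_if_risk_vanishes:
  assumes \<sigma>: "\<sigma> > 0" and iid: "iid_normal_errors n \<sigma> M \<epsilon>" and n: "n \<ge> 1"
    and est: "est \<in> estimators n"
    and \<mu>: "\<And>i. i \<in> {1..n} \<Longrightarrow> (\<lambda>k. \<mu> k i) \<longlonglongrightarrow> 0"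
    and lim: "(\<lambda>k. risk n M \<epsilon> est (\<mu> k)) \<longlonglongrightarrow> 0"
  shows "AE y in lborel_vec n. \<forall>i\<in>{1..n}. est y i = 0"
proof -
  define f where "f m y = (\<Prod>i = 1..n. normal_density (m i) \<sigma> (y i))" for m y :: "nat \<Rightarrow> real"
  define g where "g m y = (norm_vec n (\<lambda>i. est y i - m i))\<^sup>2" for m y
  have sets: "sets (borel_vec n) = sets (lborel_vec n)"
    by (simp add: borel_vec_def cong: sets_PiM_cong)
  have f_pos: "f m y > 0" for m y
    unfolding f_def by (intro prod_pos ballI normal_density_pos \<sigma>)
  note [measurable] = estimator_component_measurable[OF est]
  have g_meas: "(\<lambda>y. ennreal (g m y)) \<in> borel_measurable (borel_vec n)" for m
    unfolding g_def L2_set_def by measurable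
  have f_meas: "(\<lambda>y. ennreal (f m y)) \<in> borel_measurable (lborel_vec n)" for m
    unfolding f_def by measurable
  have fg_meas: "(\<lambda>y. ennreal (f m y * g m' y)) \<in> borel_measurable (lborel_vec n)" for m m'
  proof -
    have "(\<lambda>y. ennreal (g m' y)) \<in> borel_measurable (lborel_vec n)"
      using g_meas[of m'] unfolding measurable_cong_sets[OF sets refl] .
    with f_meas[of m] have "(\<lambda>y. ennreal (f m y) * ennreal (g m' y)) \<in> borel_measurable (lborel_vec n)"
      by measurable
    then show ?thesis by (simp add: ennreal_mult' f_pos less_imp_le)
  qed
  have loss: "(\<integral>\<^sup>+y. ennreal (f m y * g m y) \<partial>lborel_vec n) = risk n M \<epsilon> est m * of_nat n" for m
  proof -
    have "risk n M \<epsilon> est m * of_nat n = (\<integral>\<^sup>+\<omega>. ennreal (g m (observation n \<epsilon> m \<omega>)) \<partial>M)"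
      unfolding risk_def g_def using n by (intro divide_times_cancel_ennreal) auto
    also have "\<dots> = (\<integral>\<^sup>+y. (\<Prod>i = 1..n. ennreal (normal_density (m i) \<sigma> (y i))) * ennreal (g m y) \<partial>lborel_vec n)"
      by (rule nn_integral_observation[OF \<sigma> iid n g_meas])
    also have "\<dots> = (\<integral>\<^sup>+y. ennreal (f m y * g m y) \<partial>lborel_vec n)"
      by (intro nn_integral_cong) (simp add: f_def prod_ennreal ennreal_mult' prod_nonneg)
    finally show ?thesis ..
  qed
  have "(\<lambda>k. ennreal (f (\<mu> k) y * g (\<mu> k) y)) \<longlonglongrightarrow> ennreal (f (\<lambda>_. 0) y * g (\<lambda>_. 0) y)" for y
    unfolding f_def g_def L2_set_def normal_density_def
    by (intro tendsto_intros \<mu>) (use \<sigma> in auto)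
  then have "(\<integral>\<^sup>+y. ennreal (f (\<lambda>_. 0) y * g (\<lambda>_. 0) y) \<partial>lborel_vec n)
      = (\<integral>\<^sup>+y. liminf (\<lambda>k. ennreal (f (\<mu> k) y * g (\<mu> k) y)) \<partial>lborel_vec n)"
    by (intro nn_integral_cong lim_imp_Liminf[symmetric]) auto
  also have "\<dots> \<le> liminf (\<lambda>k. \<integral>\<^sup>+y. ennreal (f (\<mu> k) y * g (\<mu> k) y) \<partial>lborel_vec n)"
    by (rule nn_integral_liminf) (rule fg_meas)
  also have "\<dots> = 0"
  proof (rule lim_imp_Liminf)
    have "(\<lambda>k. of_nat n * risk n M \<epsilon> est (\<mu> k)) \<longlonglongrightarrow> of_nat n * 0"
      by (intro ennreal_tendsto_cmult lim) (simp add: of_nat_less_top)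
    then show "(\<lambda>k. \<integral>\<^sup>+y. ennreal (f (\<mu> k) y * g (\<mu> k) y) \<partial>lborel_vec n) \<longlonglongrightarrow> 0"
      unfolding loss mult.commute[of _ "of_nat n"] by (simp only: mult_zero_right)
  qed simp
  finally have "AE y in lborel_vec n. ennreal (f (\<lambda>_. 0) y * g (\<lambda>_. 0) y) = 0"
    by (simp only: le_zero_eq nn_integral_0_iff_AE[OF fg_meas])
  then show ?thesis
  proof eventually_elim
    case (elim y)
    then have "f (\<lambda>_. 0) y * g (\<lambda>_. 0) y \<le> 0" by (simp add: ennreal_eq_0_iff)
    then have "g (\<lambda>_. 0) y \<le> 0" using f_pos[of "\<lambda>_. 0" y] by (simp add: mult_le_0_iff)
    then have "L2_set (est y) {1..n} = 0" by (simp add: g_def)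
    then show ?case by (subst (asm) L2_set_eq_0_iff) auto
  qed
qed

lemma risk_of_AE_zero_estimator:
  assumes \<sigma>: "\<sigma> > 0" and iid: "iid_normal_errors n \<sigma> M \<epsilon>" and n: "n \<ge> 1"
    and est: "est \<in> estimators n"
    and zero: "AE y in lborel_vec n. \<forall>i\<in>{1..n}. est y i = 0"
  shows "risk n M \<epsilon> est \<mu> = ennreal ((norm_vec n \<mu>)\<^sup>2 / real n)"
proof -
  interpret prob_space M using iid by (simp add: iid_normal_errors_def)
  note [measurable] = estimator_component_measurable[OF est]
  have "(\<integral>\<^sup>+\<omega>. ennreal ((norm_vec n (\<lambda>i. est (observation n \<epsilon> \<mu> \<omega>) i - \<mu> i))\<^sup>2) \<partial>M)
      = (\<integral>\<^sup>+y. (\<Prod>i = 1..n. ennreal (normal_density (\<mu> i) \<sigma> (y i)))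
            * ennreal ((norm_vec n (\<lambda>i. est y i - \<mu> i))\<^sup>2) \<partial>lborel_vec n)"
    by (rule nn_integral_observation[OF \<sigma> iid n]) (unfold L2_set_def, measurable)
  also have "\<dots> = (\<integral>\<^sup>+y. (\<Prod>i = 1..n. ennreal (normal_density (\<mu> i) \<sigma> (y i)))
            * ennreal ((norm_vec n \<mu>)\<^sup>2) \<partial>lborel_vec n)"
    using zero
  proof (intro nn_integral_cong_AE, eventually_elim)
    case (elim y)
    then have "norm_vec n (\<lambda>i. est y i - \<mu> i) = norm_vec n \<mu>" by (simp add: L2_set_def)
    then show ?case by simp
  qed
  also have "\<dots> = (\<integral>\<^sup>+\<omega>. ennreal ((norm_vec n \<mu>)\<^sup>2) \<partial>M)"
    by (rule nn_integral_observation[OF \<sigma> iid n, symmetric]) simp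
  also have "\<dots> = ennreal ((norm_vec n \<mu>)\<^sup>2)" by (simp add: emeasure_space_1)
  finally show ?thesis
    unfolding risk_def using n by (simp add: ennreal_of_nat_eq_real_of_nat divide_ennreal)
qed

section \<open>The lower bound for the minimax ratio\<close>

text \<open>
  An estimator with finite worst-case ratio \<open>B\<close> has risk at most \<open>B\<close> times the optimal risk along the
  ray of constant coefficients, hence risk tending to zero at the origin. It is therefore almost
  everywhere zero, and at the corner \<open>a\<close> of the cube its ratio is
  \<open>p a\<^sup>2 / (p a\<^sup>2 v / (a\<^sup>2 + v)) = 1 + a\<^sup>2 / v\<close> with \<open>v = \<sigma>\<^sup>2 / n\<close>, which equals \<open>1 + 2 ln p\<close>.
\<close>

lemma minimax_risk_ratio_ge:
  assumes \<sigma>: "\<sigma> > 0" and iid: "iid_normal_errors n \<sigma> M \<epsilon>"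
    and basis: "complete_orthogonal_basis n p \<psi>"
    and \<Theta>: "Theta_star n p \<sigma> \<subseteq> \<Theta>" and p: "p \<ge> 2"
  shows "ennreal (1 + 2 * ln (real p)) \<le> minimax_risk_ratio n p M \<epsilon> \<psi> \<Theta>"
  unfolding minimax_risk_ratio_def
proof (rule INF_greatest)
  fix est assume est: "est \<in> estimators n"
  let ?C = "{\<mu> \<in> mean_class n p \<psi> \<Theta>. optimal_averaging_risk n p M \<epsilon> \<psi> \<mu> \<noteq> 0}"
  define B where "B = (SUP \<mu>\<in>?C. risk n M \<epsilon> est \<mu> / optimal_averaging_risk n p M \<epsilon> \<psi> \<mu>)"
  define v where "v = \<sigma>\<^sup>2 / real n"
  define a where "a = sqrt (2 * \<sigma>\<^sup>2 * ln (real p) / real n)"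
  define m where "m t = lincomb n \<psi> {1..p} (\<lambda>j\<in>{1..p}. t)" for t
  define R where "R t = real p * (t\<^sup>2 * v / (t\<^sup>2 + v))" for t
  have n: "n \<ge> 1" using basis by (auto simp: complete_orthogonal_basis_def)
  have v: "v > 0" using \<sigma> n by (simp add: v_def)
  have a: "a > 0" using \<sigma> n p by (simp add: a_def)
  have a2: "a\<^sup>2 = 2 * ln (real p) * v" using \<sigma> n p by (simp add: a_def v_def)
  have opt: "optimal_averaging_risk n p M \<epsilon> \<psi> (m t) = ennreal (R t)" for t
    unfolding m_def R_def v_def by (rule optimal_averaging_risk_constant[OF \<sigma> iid basis]) simp
  have R_pos: "R t > 0" if "t > 0" for t
    using that v p by (simp add: R_def add_pos_pos)
  have bound: "risk n M \<epsilon> est (m t) \<le> B * ennreal (R t)" if t: "0 < t" "t \<le> a" for t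
  proof -
    have "(\<lambda>j\<in>{1..p}. t) \<in> Theta_star n p \<sigma>"
      using t by (auto simp: Theta_star_def vecs_def a_def)
    then have "m t \<in> mean_class n p \<psi> \<Theta>"
      unfolding mean_class_def m_def using \<Theta> by blast
    then have "m t \<in> ?C" using R_pos[OF t(1)] by (simp add: opt)
    then have "risk n M \<epsilon> est (m t) / ennreal (R t) \<le> B"
      unfolding B_def opt[symmetric] by (rule SUP_upper)
    then have "risk n M \<epsilon> est (m t) / ennreal (R t) * ennreal (R t) \<le> B * ennreal (R t)"
      by (rule mult_right_mono) simp
    then show ?thesis using R_pos[OF t(1)] by (simp add: divide_times_cancel_ennreal)
  qed
  show "ennreal (1 + 2 * ln (real p)) \<le> B"
  proof (cases B)
    case (real b)
    define t where "t k = a / real (Suc k)" for k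
    have t: "0 < t k" "t k \<le> a" for k using a by (auto simp: t_def divide_le_eq)
    have t0: "t \<longlonglongrightarrow> 0" unfolding t_def by (rule LIMSEQ_Suc[OF lim_const_over_n])
    have "(\<lambda>k. risk n M \<epsilon> est (m (t k))) \<longlonglongrightarrow> 0"
    proof (rule tendsto_sandwich[OF _ _ tendsto_const])
      have "(\<lambda>k. b * R (t k)) \<longlonglongrightarrow> b * (real p * (0\<^sup>2 * v / (0\<^sup>2 + v)))"
        unfolding R_def by (intro tendsto_intros t0) (use v in auto)
      then have "(\<lambda>k. ennreal (b * R (t k))) \<longlonglongrightarrow> ennreal 0"
        by (intro tendsto_ennrealI) simp
      then show "(\<lambda>k. B * ennreal (R (t k))) \<longlonglongrightarrow> 0"
        using real by (simp add: ennreal_mult')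
    qed (auto intro!: always_eventually bound t)
    moreover have "(\<lambda>k. m (t k) i) \<longlonglongrightarrow> 0" if "i \<in> {1..n}" for i
    proof -
      have "(\<lambda>k. \<Sum>j = 1..p. t k * \<psi> j i) \<longlonglongrightarrow> (\<Sum>j = 1..p. 0 * \<psi> j i)"
        by (intro tendsto_intros t0)
      then show ?thesis using that by (simp add: m_def lincomb_def)
    qed
    ultimately have zero: "AE y in lborel_vec n. \<forall>i\<in>{1..n}. est y i = 0"
      by (intro AE_zero_if_risk_vanishes[OF \<sigma> iid n est])
    have norm_m: "(norm_vec n (m a))\<^sup>2 = real n * (real p * a\<^sup>2)"
      unfolding m_def parseval[OF basis] by simp
    have "risk n M \<epsilon> est (m a) = ennreal (real p * a\<^sup>2)"
      using n unfolding risk_of_AE_zero_estimator[OF \<sigma> iid n est zero] norm_m by simp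
    with bound[of a] a have "ennreal (real p * a\<^sup>2) \<le> ennreal (b * R a)"
      using real R_pos[OF a] by (simp add: ennreal_mult')
    then have "real p * a\<^sup>2 \<le> b * R a"
      using real R_pos[OF a] by (subst (asm) ennreal_le_iff) auto
    also have "\<dots> = (real p * a\<^sup>2) * (b * v / (a\<^sup>2 + v))" by (simp add: R_def)
    finally have "(real p * a\<^sup>2) * 1 \<le> (real p * a\<^sup>2) * (b * v / (a\<^sup>2 + v))" by (simp only: mult_1_right)
    moreover have "real p * a\<^sup>2 > 0" using a p by simp
    ultimately have "1 \<le> b * v / (a\<^sup>2 + v)" by (simp only: mult_le_cancel_left_pos)
    then have "a\<^sup>2 + v \<le> b * v" using a v by (simp add: le_divide_eq add_pos_pos)
    then have "(1 + 2 * ln (real p)) * v \<le> b * v" by (simp add: a2 algebra_simps)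
    then show ?thesis using v real by (simp add: ennreal_leI)
  qed simp
qed

theorem theorem2:
  fixes \<sigma> :: real
  assumes "\<sigma> > 0"
  shows
    "(\<forall>(n::nat) (p::nat) (M :: 'a measure) (\<epsilon> :: nat \<Rightarrow> 'a \<Rightarrow> real)
        (\<psi> :: nat \<Rightarrow> nat \<Rightarrow> real) (\<Theta> :: (nat \<Rightarrow> real) set).
        iid_normal_errors n \<sigma> M \<epsilon> \<and> complete_orthogonal_basis n p \<psi> \<and>
        Theta_star n p \<sigma> \<subseteq> \<Theta> \<and> \<Theta> \<subseteq> vecs p \<and> p \<ge> 2025
        \<longrightarrow> minimax_risk_ratio n p M \<epsilon> \<psi> \<Theta> > 2)
     \<and>
     (\<forall>(p :: nat \<Rightarrow> nat) (M :: nat \<Rightarrow> 'a measure) (\<epsilon> :: nat \<Rightarrow> nat \<Rightarrow> 'a \<Rightarrow> real)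
        (\<psi> :: nat \<Rightarrow> nat \<Rightarrow> nat \<Rightarrow> real) (\<Theta> :: nat \<Rightarrow> (nat \<Rightarrow> real) set).
        (\<forall>n\<ge>1. iid_normal_errors n \<sigma> (M n) (\<epsilon> n) \<and> complete_orthogonal_basis n (p n) (\<psi> n) \<and>
           Theta_star n (p n) \<sigma> \<subseteq> \<Theta> n \<and> \<Theta> n \<subseteq> vecs (p n)) \<and>
        filterlim p at_top sequentially
        \<longrightarrow> (\<exists>\<delta> :: nat \<Rightarrow> real. \<delta> \<longlonglongrightarrow> 0 \<and>
              (\<forall>n\<ge>1. minimax_risk_ratio n (p n) (M n) (\<epsilon> n) (\<psi> n) (\<Theta> n)
                       \<ge> ennreal ((1 + \<delta> n) * (2 * ln (real (p n)))))))"
proof (intro conjI allI impI, goal_cases)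
  case (1 n p M \<epsilon> \<psi> \<Theta>)
  then have "ennreal (1 + 2 * ln (real p)) \<le> minimax_risk_ratio n p M \<epsilon> \<psi> \<Theta>"
    by (intro minimax_risk_ratio_ge[OF assms]) auto
  \<comment> \<open>since \<open>exp 1 \<le> 3 \<le> p\<close>\<close>
  moreover have "ln (real p) \<ge> 1"
    using 1 exp_le by (subst ln_ge_iff) auto
  then have "ennreal 2 < ennreal (1 + 2 * ln (real p))"
    by (intro ennreal_lessI) auto
  ultimately have "ennreal 2 < minimax_risk_ratio n p M \<epsilon> \<psi> \<Theta>"
    by (rule order.strict_trans2[rotated])
  then show ?case by simp
next
  case (2 p M \<epsilon> \<psi> \<Theta>)
  \<comment> \<open>The correction term can be taken to be identically zero, including the indices with
    \<open>p n = 1\<close>, where \<open>ln (p n)\<close> vanishes.\<close>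
  have "ennreal ((1 + 0) * (2 * ln (real (p n))))
      \<le> minimax_risk_ratio n (p n) (M n) (\<epsilon> n) (\<psi> n) (\<Theta> n)" if n: "n \<ge> 1" for n
  proof (cases "p n \<ge> 2")
    case True
    have "ennreal ((1 + 0) * (2 * ln (real (p n)))) \<le> ennreal (1 + 2 * ln (real (p n)))"
      by (rule ennreal_leI) simp
    also have "\<dots> \<le> minimax_risk_ratio n (p n) (M n) (\<epsilon> n) (\<psi> n) (\<Theta> n)"
      using 2 n True by (intro minimax_risk_ratio_ge[OF assms]) auto
    finally show ?thesis .
  next
    case False
    moreover have "p n \<ge> 1" using 2 n by (auto simp: complete_orthogonal_basis_def)
    ultimately have "p n = 1" by simp
    then show ?thesis by simp
  qed
  then show ?case by (intro exI[of _ "\<lambda>_. 0"]) simp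
qed

end
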